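(* Let $k$ be a field of characteristic zero, let $A$ be the Grossman-Larson Hopf algebra of rooted trees over $k$, with unit $e$ (the one-vertex tree), counit $\varepsilon$ and comultiplication $\Delta$. Let $N(e)$ denote the rooted tree with two vertices, and let $M:A\to A$ be the $k$-linear map with $M(e)=0$ and $M(t)=tN(e)$ (product in $A$) for all rooted trees $t\neq e$. Identifying a scalar $\lambda\in k$ with $\lambda e\in A$, the following hold: (1) $M(b)=(b-\varepsilon(b))N(e)$ for all $b\in A$. (2) $M(ab)=aM(b)+M(a)\varepsilon(b)$ for all $a,b\in A$ (that is, $M$ is a derivation from $A$ into the bimodule $A$, where the left $A$-module structure of $A$ is the one given by multiplication and the right $A$-module structure is given via $\varepsilon$). (3) $\Delta(M(b))=(\mathrm{id}\otimes M+M\otimes\mathrm{id})(\Delta(b))+(b-\varepsilon(b))\otimes N(e)+N(e)\otimes(b-\varepsilon(b))$ for all $b\in A$.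
   Context: All algebras, linear spaces and tensor products are over $k$. A rooted tree is a finite, connected and simply-connected set of oriented edges and vertices with exactly one distinguished vertex with no incoming edges, the root; edges are oriented away from the root, and trees are considered up to isomorphism (no ordering of children, no labels). The children of a vertex $v$ are the endpoints of the edges outgoing from $v$. All trees are non-empty; $e$ denotes the rooted tree with only one vertex. The Hopf algebra $A$: as a vector space it has a basis consisting of all rooted trees. The unit is $e$. Product: for rooted trees $t_1,t_2$, let $s_1,\dots,s_r$ be the children of the root of $t_1$ and $n$ the number of vertices of $t_2$; there are $n^r$ ways to attach the $r$ subtrees of $t_1$ with roots $s_1,\dots,s_r$ to $t_2$ by making each $s_i$ a child of some vertex of $t_2$ (the root of the result being the root of $t_2$); $t_1t_2$ is the sum of these $n^r$ rooted trees (with multiplicity). Coproduct: if $t$ is a rooted tree whose root has children $s_1,\dots,s_r$, then $\Delta(t)$ is the sum of the $2^r$ terms $t_1\otimes t_2$, where the children of the root of $t_1$ and the children of the root of $t_2$ (together with the subtrees they carry) range over all $2^r$ ordered partitions of $\{s_1,\dots,s_r\}$ into two (possibly empty) subsets; $\Delta(e)=e\otimes e$. Counit: $\varepsilon(e)=1$, $\varepsilon(t)=0$ for $t\neq e$. It is known that $A$ is a graded connected cocommutative Hopf algebra. *)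

theory Defs
  imports Complex_Main "HOL-Library.Multiset" "HOL-Library.FuncSet"
    "HOL-Library.Poly_Mapping" "HOL-Combinatorics.Permutations"
begin

section \<open>Rooted trees\<close>

text \<open>
  The subtrees at the children of a vertex form a multiset, hence elements of
  \<open>unit ltree\<close> are exactly the isomorphism classes of (unordered, unlabelled, non-empty)
  finite rooted trees. Labelled trees serve to speak about the individual vertices of a tree:
  a tree whose labels are pairwise distinct has the set of its labels as its vertex set.
\<close>

datatype (vertices: 'v) ltree = Node (root: 'v) (children: "'v ltree multiset")
  for map: relabel

type_synonym rtree = "unit ltree"

abbreviation forget :: "'v ltree \<Rightarrow> rtree" where
  "forget \<equiv> relabel (\<lambda>_. ())"

definition tree_e :: rtree where
  "tree_e = Node () {#}"

definition tree_Ne :: rtree where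
  "tree_Ne = Node () {#tree_e#}"

primrec labels :: "'v ltree \<Rightarrow> 'v multiset" where
  "labels (Node v M) = add_mset v (\<Sum>\<^sub># (image_mset labels M))"

definition distinct_labels :: "'v ltree \<Rightarrow> bool" where
  "distinct_labels L \<longleftrightarrow> (\<forall>v. count (labels L) v \<le> 1)"

text \<open>\<open>L\<close> is the tree \<open>t\<close> with names given to its vertices.\<close>

definition is_labelling :: "rtree \<Rightarrow> 'v ltree \<Rightarrow> bool" where
  "is_labelling t L \<longleftrightarrow> forget L = t \<and> distinct_labels L"

text \<open>The trees in \<open>f v\<close> are attached as additional children of the vertex \<open>v\<close>.\<close>

primrec graft :: "('v \<Rightarrow> rtree multiset) \<Rightarrow> 'v ltree \<Rightarrow> rtree" where
  "graft f (Node v M) = Node () (f v + image_mset (graft f) M)"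


section \<open>Vector spaces with a given basis\<close>

text \<open>
  The vector space over \<open>'k\<close> with basis \<open>'b\<close> is \<open>'b \<Rightarrow>\<^sub>0 'k\<close>; the tensor product of
  the spaces with bases \<open>'b\<close> and \<open>'c\<close> is the space with basis \<open>'b \<times> 'c\<close>.
\<close>

definition scale :: "'k::field \<Rightarrow> ('b \<Rightarrow>\<^sub>0 'k) \<Rightarrow> ('b \<Rightarrow>\<^sub>0 'k)" where
  "scale c = Poly_Mapping.map ((*) c)"

definition basis :: "'b \<Rightarrow> ('b \<Rightarrow>\<^sub>0 'k::field)" where
  "basis b = Poly_Mapping.single b 1"

definition lin_ext :: "('b \<Rightarrow> ('c \<Rightarrow>\<^sub>0 'k)) \<Rightarrow> ('b \<Rightarrow>\<^sub>0 'k) \<Rightarrow> ('c \<Rightarrow>\<^sub>0 'k::field)" where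
  "lin_ext f a = (\<Sum>b\<in>Poly_Mapping.keys a. scale (Poly_Mapping.lookup a b) (f b))"

definition tensor :: "('b \<Rightarrow>\<^sub>0 'k) \<Rightarrow> ('c \<Rightarrow>\<^sub>0 'k) \<Rightarrow> ('b \<times> 'c \<Rightarrow>\<^sub>0 'k::field)"
    (infixl "\<otimes>" 75) where
  "a \<otimes> b = lin_ext (\<lambda>s. lin_ext (\<lambda>t. basis (s, t)) b) a"

text \<open>The tensor product of two linear maps.\<close>

definition tensor_map ::
  "(('a \<Rightarrow>\<^sub>0 'k) \<Rightarrow> ('c \<Rightarrow>\<^sub>0 'k)) \<Rightarrow> (('b \<Rightarrow>\<^sub>0 'k) \<Rightarrow> ('d \<Rightarrow>\<^sub>0 'k)) \<Rightarrow>
    ('a \<times> 'b \<Rightarrow>\<^sub>0 'k) \<Rightarrow> ('c \<times> 'd \<Rightarrow>\<^sub>0 'k::field)" where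
  "tensor_map f g = lin_ext (\<lambda>(s, t). f (basis s) \<otimes> g (basis t))"

lemma lookup_scale [simp]: "Poly_Mapping.lookup (scale c a) b = c * Poly_Mapping.lookup a b"
  by (simp add: scale_def Poly_Mapping.map.rep_eq when_def)

lemma vector_space_scale: "vector_space (scale :: 'k::field \<Rightarrow> ('b \<Rightarrow>\<^sub>0 'k) \<Rightarrow> _)"
  by unfold_locales (auto intro!: poly_mapping_eqI simp: lookup_add algebra_simps)

interpretation scale: vector_space "scale :: 'k::field \<Rightarrow> ('b \<Rightarrow>\<^sub>0 'k) \<Rightarrow> _"
  by (rule vector_space_scale)

lemma lin_ext_superset:
  assumes "finite K" "Poly_Mapping.keys a \<subseteq> K"
  shows "lin_ext f a = (\<Sum>b\<in>K. scale (Poly_Mapping.lookup a b) (f b))"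
  unfolding lin_ext_def using assms
  by (intro sum.mono_neutral_left) (auto simp: in_keys_iff)

lemma lin_ext_basis [simp]: "lin_ext f (basis b) = f b"
  by (simp add: lin_ext_def basis_def)

lemma linear_lin_ext:
  fixes f :: "'b \<Rightarrow> ('c \<Rightarrow>\<^sub>0 'k::field)"
  shows "Vector_Spaces.linear scale scale (lin_ext f)"
proof unfold_locales
  fix a a' :: "'b \<Rightarrow>\<^sub>0 'k" and c :: 'k
  let ?K = "Poly_Mapping.keys a \<union> Poly_Mapping.keys a'"
  have "lin_ext f (a + a') = (\<Sum>b\<in>?K. scale (Poly_Mapping.lookup (a + a') b) (f b))"
    by (rule lin_ext_superset) (auto dest: subsetD[OF keys_add])
  then show "lin_ext f (a + a') = lin_ext f a + lin_ext f a'"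
    by (simp add: lin_ext_superset[of ?K] lookup_add scale.scale_left_distrib sum.distrib)
  have "lin_ext f (scale c a) =
      (\<Sum>b\<in>Poly_Mapping.keys a. scale (Poly_Mapping.lookup (scale c a) b) (f b))"
    by (rule lin_ext_superset) (auto simp: in_keys_iff)
  then show "lin_ext f (scale c a) = scale c (lin_ext f a)"
    by (simp add: lin_ext_def scale.scale_sum_right)
qed


section \<open>The Grossman--Larson Hopf algebra\<close>

definition attach_sum :: "rtree list \<Rightarrow> 'v ltree \<Rightarrow> (rtree \<Rightarrow>\<^sub>0 'k::field)" where
  "attach_sum ss L = (\<Sum>\<phi> \<in> {..<length ss} \<rightarrow>\<^sub>E vertices L.
     basis (graft (\<lambda>v. image_mset ((!) ss) (mset_set {i. i < length ss \<and> \<phi> i = v})) L))"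

definition split_sum :: "rtree list \<Rightarrow> (rtree \<times> rtree \<Rightarrow>\<^sub>0 'k::field)" where
  "split_sum ss = (\<Sum>I \<in> Pow {..<length ss}.
     basis (Node () (image_mset ((!) ss) (mset_set I))) \<otimes>
     basis (Node () (image_mset ((!) ss) (mset_set ({..<length ss} - I)))))"

text \<open>
  The choices of an enumeration of the subtrees at the children of the root and of names for
  the vertices are immaterial, see \<open>tree_mult_eq\<close> and \<open>tree_coprod_eq\<close> below.
\<close>

definition tree_mult :: "rtree \<Rightarrow> rtree \<Rightarrow> (rtree \<Rightarrow>\<^sub>0 'k::field)" where
  "tree_mult t1 t2 =
     attach_sum (SOME ss. mset ss = children t1) (SOME L :: nat ltree. is_labelling t2 L)"

definition tree_coprod :: "rtree \<Rightarrow> (rtree \<times> rtree \<Rightarrow>\<^sub>0 'k::field)" where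
  "tree_coprod t = split_sum (SOME ss. mset ss = children t)"

definition gl_mult :: "(rtree \<Rightarrow>\<^sub>0 'k) \<Rightarrow> (rtree \<Rightarrow>\<^sub>0 'k) \<Rightarrow> (rtree \<Rightarrow>\<^sub>0 'k::field)"
    (infixl "\<star>" 70) where
  "a \<star> b = lin_ext (\<lambda>s. lin_ext (\<lambda>t. tree_mult s t) b) a"

definition gl_coprod :: "(rtree \<Rightarrow>\<^sub>0 'k) \<Rightarrow> (rtree \<times> rtree \<Rightarrow>\<^sub>0 'k::field)" ("\<Delta>") where
  "\<Delta> = lin_ext tree_coprod"

definition gl_counit :: "(rtree \<Rightarrow>\<^sub>0 'k) \<Rightarrow> 'k::field" ("\<epsilon>") where
  "\<epsilon> a = (\<Sum>t\<in>Poly_Mapping.keys a. Poly_Mapping.lookup a t * (if t = tree_e then 1 else 0))"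

definition gl_scalar :: "'k::field \<Rightarrow> (rtree \<Rightarrow>\<^sub>0 'k)" where
  "gl_scalar c = scale c (basis tree_e)"

definition gl_M :: "(rtree \<Rightarrow>\<^sub>0 'k) \<Rightarrow> (rtree \<Rightarrow>\<^sub>0 'k::field)" where
  "gl_M = lin_ext (\<lambda>t. if t = tree_e then 0 else basis t \<star> basis tree_Ne)"


subsection \<open>Independence of the choices\<close>

lemma set_mset_labels [simp]: "set_mset (labels L) = vertices L"
  by (induction L) auto

lemma finite_vertices [simp]: "finite (vertices L)"
  by (metis finite_set_mset set_mset_labels)

lemma image_mset_sum_mset: "image_mset f (\<Sum>\<^sub># A) = (\<Sum>\<^sub># (image_mset (image_mset f) A))"
  by (induction A) auto

lemma labels_relabel: "labels (relabel f L) = image_mset f (labels L)"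
proof (induction L)
  case (Node v M)
  have "image_mset (labels \<circ> relabel f) M = image_mset (image_mset f \<circ> labels) M"
    using Node by (intro image_mset_cong) auto
  then show ?case
    by (simp add: multiset.map_comp image_mset_sum_mset)
qed

lemma graft_relabel: "graft g (relabel f L) = graft (g \<circ> f) L"
  by (induction L) (auto simp: multiset.map_comp intro!: image_mset_cong)

lemma graft_cong: "(\<And>v. v \<in> vertices L \<Longrightarrow> f v = g v) \<Longrightarrow> graft f L = graft g L"
proof (induction L)
  case (Node v M)
  then show ?case by (auto intro!: image_mset_cong)
qed

lemma distinct_labels_relabelD:
  assumes "distinct_labels (relabel f L)"
  shows "inj_on f (vertices L)"
proof (rule inj_onI, rule ccontr)
  fix v w assume vw: "v \<in> vertices L" "w \<in> vertices L" "f v = f w" "v \<noteq> w"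
  then obtain N where "labels L = add_mset v (add_mset w N)"
    by (metis insert_noteq_member multi_member_split set_mset_labels)
  then have "count (labels (relabel f L)) (f v) \<ge> 2"
    using vw by (simp add: labels_relabel)
  moreover have "count (labels (relabel f L)) (f v) \<le> 1"
    using assms by (simp add: distinct_labels_def)
  ultimately show False by simp
qed

lemma forget_eqD:
  assumes "forget L = forget L'"
  shows "rel_ltree (\<lambda>_ _. True) L L'"
  using assms
proof (induction L arbitrary: L')
  case (Node v M)
  obtain w M' where L': "L' = Node w M'" by (cases L')
  have "rel_mset (=) (image_mset forget M) (image_mset forget M')"
    using Node.prems L' by (simp add: multiset.rel_eq)
  then have "rel_mset (\<lambda>x y. forget x = forget y) M M'"
    by (simp add: multiset.rel_map)
  then have "rel_mset (rel_ltree (\<lambda>_ _. True)) M M'"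
    by (rule multiset.rel_mono_strong) (use Node.IH in auto)
  then show ?case using L' by simp
qed

lemma attach_sum_relabel:
  assumes "inj_on f (vertices Z)"
  shows "attach_sum ss (relabel f Z) = attach_sum ss Z"
  unfolding attach_sum_def
proof (rule sum.reindex_bij_witness[where
      i = "\<lambda>\<phi>. restrict (\<lambda>i. f (\<phi> i)) {..<length ss}" and
      j = "\<lambda>\<psi>. restrict (\<lambda>i. inv_into (vertices Z) f (\<psi> i)) {..<length ss}"])
  fix \<psi> assume \<psi>: "\<psi> \<in> {..<length ss} \<rightarrow>\<^sub>E vertices (relabel f Z)"
  then have im: "\<psi> i \<in> f ` vertices Z" if "i < length ss" for i
    using that by (auto simp: ltree.set_map)
  show "restrict (\<lambda>i. f (restrict (\<lambda>i. inv_into (vertices Z) f (\<psi> i)) {..<length ss} i))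
      {..<length ss} = \<psi>"
    using im by (intro PiE_ext[OF _ \<psi>]) (auto simp: f_inv_into_f ltree.set_map)
  show "restrict (\<lambda>i. inv_into (vertices Z) f (\<psi> i)) {..<length ss} \<in>
      {..<length ss} \<rightarrow>\<^sub>E vertices Z"
    using im by (auto intro: inv_into_into)
  have eq: "restrict (\<lambda>i. inv_into (vertices Z) f (\<psi> i)) {..<length ss} i = v \<longleftrightarrow> \<psi> i = f v"
    if "i < length ss" "v \<in> vertices Z" for i v
    using that im[OF that(1)] assms by (auto simp: f_inv_into_f inj_on_eq_iff)
  have "graft (\<lambda>v. image_mset ((!) ss) (mset_set {i. i < length ss \<and>
      restrict (\<lambda>i. inv_into (vertices Z) f (\<psi> i)) {..<length ss} i = v})) Z =
    graft (\<lambda>v. image_mset ((!) ss) (mset_set {i. i < length ss \<and> \<psi> i = v})) (relabel f Z)"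
    unfolding graft_relabel
  proof (rule graft_cong)
    fix v assume "v \<in> vertices Z"
    then have "{i. i < length ss \<and> restrict (\<lambda>i. inv_into (vertices Z) f (\<psi> i)) {..<length ss} i = v}
      = {i. i < length ss \<and> \<psi> i = f v}"
      using eq by blast
    then show "image_mset ((!) ss) (mset_set {i. i < length ss \<and>
        restrict (\<lambda>i. inv_into (vertices Z) f (\<psi> i)) {..<length ss} i = v}) =
      ((\<lambda>v. image_mset ((!) ss) (mset_set {i. i < length ss \<and> \<psi> i = v})) \<circ> f) v"
      by simp
  qed
  then show "basis (graft (\<lambda>v. image_mset ((!) ss) (mset_set {i. i < length ss \<and>
      restrict (\<lambda>i. inv_into (vertices Z) f (\<psi> i)) {..<length ss} i = v})) Z) =
    basis (graft (\<lambda>v. image_mset ((!) ss) (mset_set {i. i < length ss \<and> \<psi> i = v})) (relabel f Z))"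
    by simp
next
  fix \<phi> assume \<phi>: "\<phi> \<in> {..<length ss} \<rightarrow>\<^sub>E vertices Z"
  then show "restrict (\<lambda>i. f (\<phi> i)) {..<length ss} \<in> {..<length ss} \<rightarrow>\<^sub>E vertices (relabel f Z)"
    by (auto simp: ltree.set_map)
  have "inv_into (vertices Z) f (f (\<phi> i)) = \<phi> i" if "i < length ss" for i
    using \<phi> that assms by (auto intro!: inv_into_f_f)
  then show "restrict (\<lambda>i. inv_into (vertices Z) f (restrict (\<lambda>i. f (\<phi> i)) {..<length ss} i))
      {..<length ss} = \<phi>"
    using \<phi> by (intro PiE_ext[OF _ \<phi>]) auto
qed

lemma attach_sum_forget_eq:
  assumes "forget L = forget L'" "distinct_labels L" "distinct_labels L'"
  shows "(attach_sum ss L :: rtree \<Rightarrow>\<^sub>0 'k::field) = attach_sum ss L'"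
proof -
  from forget_eqD[OF assms(1)] obtain Z where Z: "relabel fst Z = L" "relabel snd Z = L'"
    by (auto simp: ltree.in_rel)
  then have "(attach_sum ss L :: rtree \<Rightarrow>\<^sub>0 'k) = attach_sum ss Z"
    "(attach_sum ss L' :: rtree \<Rightarrow>\<^sub>0 'k) = attach_sum ss Z"
    using assms attach_sum_relabel distinct_labels_relabelD by blast+
  then show ?thesis by simp
qed

lemma image_mset_permute:
  assumes "p permutes {..<length ss}" "X \<subseteq> {..<length ss}"
  shows "image_mset ((!) (permute_list p ss)) (mset_set X) = image_mset ((!) ss) (mset_set (p ` X))"
proof -
  have "finite X" using assms(2) finite_subset by blast
  have "image_mset ((!) (permute_list p ss)) (mset_set X) =
      image_mset ((!) ss) (image_mset p (mset_set X))"
    unfolding multiset.map_comp using assms \<open>finite X\<close>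
    by (intro image_mset_cong) (auto simp: permute_list_nth)
  also have "image_mset p (mset_set X) = mset_set (p ` X)"
    using assms by (intro image_mset_mset_set) (meson inj_on_subset permutes_inj_on subset_UNIV)
  finally show ?thesis .
qed

lemma attach_sum_mset_eq:
  assumes "mset ss = mset ss'"
  shows "attach_sum ss L = attach_sum ss' L"
proof -
  obtain p where p: "p permutes {..<length ss'}" "permute_list p ss' = ss"
    using mset_eq_permutation[OF assms] .
  have len: "length ss = length ss'" using assms by (rule mset_eq_length)
  note q = permutes_inv[OF p(1)]
  have *: "\<phi> \<circ> r \<in> {..<length ss'} \<rightarrow>\<^sub>E vertices L"
    if "\<phi> \<in> {..<length ss'} \<rightarrow>\<^sub>E vertices L" "r permutes {..<length ss'}" for \<phi> r
  proof (rule PiE_I)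
    fix i assume "i \<in> {..<length ss'}"
    then have "r i \<in> {..<length ss'}" using permutes_in_image[OF that(2)] by blast
    then show "(\<phi> \<circ> r) i \<in> vertices L" using that(1) by auto
  next
    fix i assume "i \<notin> {..<length ss'}"
    then show "(\<phi> \<circ> r) i = undefined"
      using that by (auto simp: permutes_not_in intro: PiE_arb)
  qed
  show ?thesis
    unfolding attach_sum_def len
  proof (rule sum.reindex_bij_witness[where i = "\<lambda>\<phi>. \<phi> \<circ> p" and j = "\<lambda>\<phi>. \<phi> \<circ> inv p"])
    fix \<phi> assume \<phi>: "\<phi> \<in> {..<length ss'} \<rightarrow>\<^sub>E vertices L"
    show "\<phi> \<circ> inv p \<circ> p = \<phi>"
      using p(1) by (simp add: o_assoc[symmetric] permutes_inv_o)
    show "\<phi> \<circ> inv p \<in> {..<length ss'} \<rightarrow>\<^sub>E vertices L" by (rule *[OF \<phi> q])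
    have "image_mset ((!) ss) (mset_set {i. i < length ss' \<and> \<phi> i = v}) =
        image_mset ((!) ss') (mset_set {i. i < length ss' \<and> (\<phi> \<circ> inv p) i = v})" for v
    proof -
      have "p ` {i. i < length ss' \<and> \<phi> i = v} = {i. i < length ss' \<and> (\<phi> \<circ> inv p) i = v}"
        (is "p ` ?A = ?B")
      proof (intro equalityI subsetI)
        fix j assume "j \<in> p ` ?A"
        then obtain i where i: "i < length ss'" "\<phi> i = v" "j = p i" by blast
        then have "j < length ss'" using permutes_in_image[OF p(1), of i] by simp
        then show "j \<in> ?B" using i permutes_inverses(2)[OF p(1)] by simp
      next
        fix j assume j: "j \<in> ?B"
        then have "inv p j < length ss'" using permutes_in_image[OF q, of j] by simp
        moreover have "p (inv p j) = j" using permutes_inverses(1)[OF p(1)] .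
        ultimately show "j \<in> p ` ?A" using j by (intro image_eqI[of _ _ "inv p j"]) auto
      qed
      then show ?thesis
        using image_mset_permute[OF p(1), of ?A] p(2) by auto
    qed
    then show "basis (graft (\<lambda>v. image_mset ((!) ss')
          (mset_set {i. i < length ss' \<and> (\<phi> \<circ> inv p) i = v})) L) =
        basis (graft (\<lambda>v. image_mset ((!) ss) (mset_set {i. i < length ss' \<and> \<phi> i = v})) L)"
      by simp
  next
    fix \<phi> assume \<phi>: "\<phi> \<in> {..<length ss'} \<rightarrow>\<^sub>E vertices L"
    show "\<phi> \<circ> p \<circ> inv p = \<phi>"
      using p(1) by (simp add: o_assoc[symmetric] permutes_inv_o)
    show "\<phi> \<circ> p \<in> {..<length ss'} \<rightarrow>\<^sub>E vertices L" by (rule *[OF \<phi> p(1)])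
  qed
qed

lemma split_sum_mset_eq:
  assumes "mset ss = mset ss'"
  shows "split_sum ss = split_sum ss'"
proof -
  obtain p where p: "p permutes {..<length ss'}" "permute_list p ss' = ss"
    using mset_eq_permutation[OF assms] .
  have len: "length ss = length ss'" using assms by (rule mset_eq_length)
  have im: "p ` {..<length ss'} = {..<length ss'}" by (rule permutes_image[OF p(1)])
  have inj: "inj p" by (rule permutes_inj[OF p(1)])
  have "bij_betw (\<lambda>I. p ` I) (Pow {..<length ss'}) (Pow {..<length ss'})"
    using bij_betw_Pow[OF permutes_imp_bij[OF p(1)]] .
  moreover have "image_mset ((!) ss) (mset_set I) = image_mset ((!) ss') (mset_set (p ` I))"
    if "I \<subseteq> {..<length ss'}" for I
    using image_mset_permute[OF p(1) that] p(2) by simp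
  moreover have "p ` ({..<length ss'} - I) = {..<length ss'} - p ` I" for I
    using im by (simp add: image_set_diff[OF inj])
  ultimately show ?thesis
    unfolding split_sum_def len
    by (subst sum.reindex_bij_betw[symmetric, where h = "\<lambda>I. p ` I"]) (auto intro!: sum.cong)
qed

lemma ex_labelling_ge: "\<exists>L. is_labelling t L \<and> vertices L \<subseteq> {n::nat..}"
proof (induction t arbitrary: n)
  case (Node u M)
  have "\<exists>M'. image_mset forget M' = M \<and> (\<forall>v. count (\<Sum>\<^sub># (image_mset labels M')) v \<le> 1) \<and>
      set_mset (\<Sum>\<^sub># (image_mset labels M')) \<subseteq> {Suc n..}"
    using Node.IH
  proof (induction M)
    case empty
    show ?case by (rule exI[of _ "{#}"]) auto
  next
    case (add t M)
    then obtain M' where M': "image_mset forget M' = M"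
      "\<And>v. count (\<Sum>\<^sub># (image_mset labels M')) v \<le> 1"
      "set_mset (\<Sum>\<^sub># (image_mset labels M')) \<subseteq> {Suc n..}"
      by (metis insert_iff set_mset_add_mset_insert)
    let ?S = "\<Sum>\<^sub># (image_mset labels M')"
    define m where "m = Suc (Max (insert n (set_mset ?S)))"
    have m: "Suc n \<le> m" "\<And>v. v \<in># ?S \<Longrightarrow> v < m"
      unfolding m_def by (auto simp: less_Suc_eq_le)
    from add.prems[of t m] obtain L where L: "forget L = t" "distinct_labels L" "vertices L \<subseteq> {m..}"
      by (auto simp: is_labelling_def)
    have "count (labels L) v + count ?S v \<le> 1" for v
    proof (cases "v \<in># ?S")
      case True
      then have "v \<notin># labels L" using m(2) L(3) by fastforce
      then show ?thesis using M'(2)[of v] by (simp add: not_in_iff del: set_mset_labels)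
    next
      case False
      then have "count ?S v = 0" by (simp only: not_in_iff)
      then show ?thesis using L(2) by (simp add: distinct_labels_def)
    qed
    moreover have "set_mset (labels L) \<subseteq> {Suc n..}" using L(3) m(1) by auto
    ultimately show ?case
      using M' L by (intro exI[of _ "add_mset L M'"]) auto
  qed
  then obtain M' where M': "image_mset forget M' = M"
      "\<And>v. count (\<Sum>\<^sub># (image_mset labels M')) v \<le> 1"
      "set_mset (\<Sum>\<^sub># (image_mset labels M')) \<subseteq> {Suc n..}"
    by blast
  have "n \<notin># \<Sum>\<^sub># (image_mset labels M')" using M'(3) by force
  then have "count (\<Sum>\<^sub># (image_mset labels M')) n = 0" by (simp only: not_in_iff)
  then have "distinct_labels (Node n M')"
    using M'(2) by (simp add: distinct_labels_def)
  moreover have "vertices (Node n M') \<subseteq> {n..}"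
    using M'(3) by (subst set_mset_labels[symmetric]) (auto simp del: set_mset_labels)
  ultimately show ?case
    using M'(1) by (intro exI[of _ "Node n M'"]) (simp add: is_labelling_def)
qed

theorem tree_mult_eq:
  assumes "mset ss = children t1" "is_labelling t2 L"
  shows "(tree_mult t1 t2 :: rtree \<Rightarrow>\<^sub>0 'k::field) = attach_sum ss L"
proof -
  let ?ss = "SOME ss. mset ss = children t1" and ?L = "SOME L :: nat ltree. is_labelling t2 L"
  have "mset ?ss = children t1" using assms(1) by (rule someI)
  moreover have "is_labelling t2 ?L" using ex_labelling_ge[of t2] by (metis someI)
  ultimately have "(attach_sum ?ss ?L :: rtree \<Rightarrow>\<^sub>0 'k) = attach_sum ?ss L"
    "(attach_sum ?ss L :: rtree \<Rightarrow>\<^sub>0 'k) = attach_sum ss L"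
    using assms by (auto simp: is_labelling_def intro: attach_sum_forget_eq attach_sum_mset_eq)
  then show ?thesis by (simp add: tree_mult_def)
qed

theorem tree_coprod_eq:
  assumes "mset ss = children t"
  shows "tree_coprod t = split_sum ss"
proof -
  have "mset (SOME ss. mset ss = children t) = children t" using assms by (rule someI)
  then show ?thesis unfolding tree_coprod_def using assms by (intro split_sum_mset_eq) simp
qed

end

theory Submission
  imports Defs
begin

text \<open>
  Statement (2) amounts to \<open>(ab)N(e) = a(bN(e))\<close>. For a tree \<open>t\<close>, the product \<open>tN(e)\<close> is the
  image of \<open>\<Delta>(t)\<close> under the linear map \<open>G\<close> that makes the root of the second tree a child of the
  root of the first one. Since \<open>s \<cdot> G(x \<otimes> y) = G(\<Delta>(s)(x \<otimes> y))\<close> (subtrees of \<open>s\<close> are attached to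
  vertices of \<open>x\<close> or of \<open>y\<close>), (2) follows from \<open>\<Delta>(st) = \<Delta>(s)\<Delta>(t)\<close>, which in turn is proved
  by induction on the number of children of the root of \<open>t\<close> with the same identity for \<open>G\<close>.
  Statement (3) is coassociativity and cocommutativity applied to \<open>\<Delta>(G(\<Delta>(t)))\<close>.
\<close>

section \<open>Splitting and distributing multisets\<close>

text \<open>Equal elements count as distinguishable, so n elements give 2^n pairs with multiplicity,
  as the coproduct requires. Sums over \<open>splits\<close> need no enumeration of the children and
  can be treated by adding one child at a time.\<close>

definition splits :: "'a multiset \<Rightarrow> ('a multiset \<times> 'a multiset) multiset" where
  "splits = fold_mset (\<lambda>s X. image_mset (apfst (add_mset s)) X + image_mset (apsnd (add_mset s)) X)
     {#({#}, {#})#}"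

lemma splits_empty [simp]: "splits {#} = {#({#}, {#})#}"
  by (simp add: splits_def)

lemma splits_add_mset:
  "splits (add_mset s M) =
     image_mset (apfst (add_mset s)) (splits M) + image_mset (apsnd (add_mset s)) (splits M)"
proof -
  interpret comp_fun_commute
    "\<lambda>s X. image_mset (apfst (add_mset s)) X + image_mset (apsnd (add_mset s)) X"
    by standard (auto simp: fun_eq_iff multiset.map_comp o_def apfst_def apsnd_def map_prod_def
        case_prod_unfold add_mset_commute add_ac)
  show ?thesis by (simp add: splits_def)
qed

lemma sum_splits_add_mset:
  "(\<Sum>(A, B)\<in>#splits (add_mset s M). F A B) =
     (\<Sum>(A, B)\<in>#splits M. F (add_mset s A) B + F A (add_mset s B))"
  by (simp add: splits_add_mset multiset.map_comp o_def case_prod_unfold sum_mset.distrib)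

lemma splits_image_mset:
  "splits (image_mset f M) = image_mset (map_prod (image_mset f) (image_mset f)) (splits M)"
  by (induction M) (auto simp: splits_add_mset multiset.map_comp o_def case_prod_unfold apfst_def
      apsnd_def map_prod_def)

lemma splitsD: "(A, B) \<in># splits M \<Longrightarrow> M = A + B"
  by (induction M arbitrary: A B) (auto simp: splits_add_mset apfst_def apsnd_def map_prod_def)

lemma sum_splits_cong:
  "(\<And>A B. M = A + B \<Longrightarrow> F A B = G A B) \<Longrightarrow>
    (\<Sum>(A, B)\<in>#splits M. F A B) = (\<Sum>(A, B)\<in>#splits M. G A B)"
  by (auto intro!: arg_cong[of _ _ sum_mset] image_mset_cong dest: splitsD)

lemma splits_comm: "(\<Sum>(A, B)\<in>#splits M. F A B) = (\<Sum>(A, B)\<in>#splits M. F B A)"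
  by (induction M arbitrary: F) (simp_all add: sum_splits_add_mset add.commute)

text \<open>Both sides run over the ordered partitions of \<open>M\<close> into three blocks, and a
  new element \<open>s\<close> joins exactly one of them. This is coassociativity in combinatorial
  form.\<close>

lemma splits_assoc:
  "(\<Sum>(A, B)\<in>#splits M. \<Sum>(A1, A2)\<in>#splits A. F A1 A2 B) =
   (\<Sum>(A, B)\<in>#splits M. \<Sum>(B1, B2)\<in>#splits B. F A B1 B2)"
proof (induction M arbitrary: F)
  case (add s M)
  have "(\<Sum>(A, B)\<in>#splits (add_mset s M). \<Sum>(A1, A2)\<in>#splits A. F A1 A2 B) =
     (\<Sum>(A, B)\<in>#splits M. \<Sum>(A1, A2)\<in>#splits A.
        F (add_mset s A1) A2 B + F A1 (add_mset s A2) B + F A1 A2 (add_mset s B))"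
    unfolding sum_splits_add_mset by (simp add: sum_mset.distrib case_prod_unfold)
  also have "\<dots> = (\<Sum>(A, B)\<in>#splits M. \<Sum>(B1, B2)\<in>#splits B.
        F (add_mset s A) B1 B2 + F A (add_mset s B1) B2 + F A B1 (add_mset s B2))"
    by (rule add)
  also have "\<dots> = (\<Sum>(A, B)\<in>#splits (add_mset s M). \<Sum>(B1, B2)\<in>#splits B. F A B1 B2)"
    unfolding sum_splits_add_mset by (simp add: sum_mset.distrib case_prod_unfold add_ac)
  finally show ?case .
qed simp

text \<open>After \<open>splits_assoc\<close> the last two blocks come from splitting one multiset,
  so \<open>splits_comm\<close> exchanges them.\<close>

lemma splits_rotate:
  "(\<Sum>(A, B)\<in>#splits M. \<Sum>(A1, A2)\<in>#splits A. F A1 A2 B) =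
   (\<Sum>(A, B)\<in>#splits M. \<Sum>(A1, A2)\<in>#splits A. F A1 B A2)"
  unfolding splits_assoc by (subst splits_comm) (rule refl)

text \<open>Exactly one split has an empty second block. A single term can therefore be spread over
  all splits, which later supplies the summand killed by M(e) = 0.\<close>

lemma sum_splits_right_empty:
  "(\<Sum>(A, B)\<in>#splits M. if B = {#} then F A else 0) = F M"
  by (induction M arbitrary: F) (simp_all add: sum_splits_add_mset)

lemma sum_splits_left_empty:
  "(\<Sum>(A, B)\<in>#splits M. if A = {#} then F B else 0) = F M"
  by (subst splits_comm) (rule sum_splits_right_empty)

text \<open>Passes from the index sets of \<open>split_sum\<close> to \<open>splits\<close>. The
  list grows at its end so that old positions keep their numbers; a set of positions either omits or
  contains the new one, which gives the two summands of \<open>sum_splits_add_mset\<close>.\<close>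

lemma sum_Pow_eq_sum_splits:
  "(\<Sum>I\<in>Pow {..<length ss}. F (image_mset ((!) ss) (mset_set I))
       (image_mset ((!) ss) (mset_set ({..<length ss} - I)))) =
   (\<Sum>(A, B)\<in>#splits (mset ss). F A B)"
proof (induction ss arbitrary: F rule: rev_induct)
  case (snoc s ss)
  let ?n = "length ss"
  let ?f = "\<lambda>I. image_mset ((!) ss) (mset_set I)"
  let ?g = "\<lambda>I. image_mset ((!) (ss @ [s])) (mset_set I)"
  have old: "?g I = ?f I" if "I \<subseteq> {..<?n}" for I
    using that finite_subset[OF that] by (intro image_mset_cong) (auto simp: nth_append)
  have new: "?g (insert ?n I) = add_mset s (?f I)" if "I \<subseteq> {..<?n}" for I
  proof -
    have "?n \<notin> I" "finite I" using that finite_subset[OF that] by auto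
    then show ?thesis using old[OF that] by simp
  qed
  have inj: "inj_on (insert ?n) (Pow {..<?n})"
    by (rule inj_onI) (metis Diff_insert_absorb Pow_iff lessThan_iff less_irrefl subsetD)
  have "(\<Sum>I\<in>Pow {..<Suc ?n}. F (?g I) (?g ({..<Suc ?n} - I))) =
      (\<Sum>I\<in>Pow {..<?n}. F (?g I) (?g ({..<Suc ?n} - I))) +
      (\<Sum>I\<in>insert ?n ` Pow {..<?n}. F (?g I) (?g ({..<Suc ?n} - I)))"
    unfolding lessThan_Suc Pow_insert by (rule sum.union_disjoint) auto
  also have "(\<Sum>I\<in>Pow {..<?n}. F (?g I) (?g ({..<Suc ?n} - I))) =
      (\<Sum>I\<in>Pow {..<?n}. F (?f I) (add_mset s (?f ({..<?n} - I))))"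
  proof (rule sum.cong)
    fix I assume "I \<in> Pow {..<?n}"
    then have "{..<Suc ?n} - I = insert ?n ({..<?n} - I)" "I \<subseteq> {..<?n}" by auto
    then show "F (?g I) (?g ({..<Suc ?n} - I)) = F (?f I) (add_mset s (?f ({..<?n} - I)))"
      using old new[of "{..<?n} - I"] by auto
  qed simp
  also have "\<dots> = (\<Sum>(A, B)\<in>#splits (mset ss). F A (add_mset s B))"
    by (rule snoc)
  also have "(\<Sum>I\<in>insert ?n ` Pow {..<?n}. F (?g I) (?g ({..<Suc ?n} - I))) =
      (\<Sum>I\<in>Pow {..<?n}. F (?g (insert ?n I)) (?g ({..<Suc ?n} - insert ?n I)))"
    by (simp add: sum.reindex[OF inj])
  also have "\<dots> = (\<Sum>I\<in>Pow {..<?n}. F (add_mset s (?f I)) (?f ({..<?n} - I)))"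
  proof (rule sum.cong)
    fix I assume "I \<in> Pow {..<?n}"
    then have "{..<Suc ?n} - insert ?n I = {..<?n} - I" "I \<subseteq> {..<?n}" by auto
    then show "F (?g (insert ?n I)) (?g ({..<Suc ?n} - insert ?n I)) =
        F (add_mset s (?f I)) (?f ({..<?n} - I))"
      using old[of "{..<?n} - I"] new by auto
  qed simp
  also have "\<dots> = (\<Sum>(A, B)\<in>#splits (mset ss). F (add_mset s A) B)"
    by (rule snoc)
  finally show ?case
    by (simp only: length_append_singleton mset_append mset.simps union_mset_add_mset_right
        add_0_right sum_splits_add_mset) (simp add: sum_mset.distrib case_prod_unfold add.commute)
qed simp

text \<open>The placements of the elements of a multiset on the points of a finite \<open>V\<close>,
  |V|^n of them for n elements. Each is recorded as the function that \<open>graft\<close> expects,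
  and the multiplicities are those of the product.\<close>

definition distribute :: "'v set \<Rightarrow> 'a multiset \<Rightarrow> ('v \<Rightarrow> 'a multiset) multiset" where
  "distribute V = fold_mset (\<lambda>s X. \<Sum>v\<in>#mset_set V. image_mset (\<lambda>f. f(v := add_mset s (f v))) X)
     {#\<lambda>_. {#}#}"

lemma distribute_empty [simp]: "distribute V {#} = {#\<lambda>_. {#}#}"
  by (simp add: distribute_def)

lemma distribute_add_mset:
  fixes M :: "'a multiset"
  shows "distribute V (add_mset s M) =
     (\<Sum>v\<in>#mset_set V. image_mset (\<lambda>f. f(v := add_mset s (f v))) (distribute V M))"
proof -
  let ?F = "\<lambda>(s :: 'a) X. \<Sum>v\<in>#mset_set V. image_mset (\<lambda>f. f(v := add_mset s (f v))) X"
  have F: "?F s (?F r X) = (\<Sum>v\<in>#mset_set V. \<Sum>w\<in>#mset_set V.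
      image_mset (\<lambda>f. (f(w := add_mset r (f w)))
        (v := add_mset s ((f(w := add_mset r (f w))) v))) X)" for s r :: 'a and X
    by (simp add: image_mset_sum_mset multiset.map_comp o_def)
  interpret comp_fun_commute ?F
  proof
    fix s r :: 'a
    \<comment> \<open>The fold is well defined because placing \<open>s\<close> and \<open>r\<close>
      commutes, also when both land on the same point.\<close>
    have "?F s (?F r X) = ?F r (?F s X)" for X
      unfolding F
      by (subst sum_mset.swap)
        (auto intro!: arg_cong[of _ _ sum_mset] image_mset_cong simp: fun_eq_iff add_mset_commute)
    then show "?F s \<circ> ?F r = ?F r \<circ> ?F s" by (simp add: fun_eq_iff)
  qed
  show ?thesis by (simp add: distribute_def)
qed

lemma sum_mset_sum_mset:
  "(\<Sum>x\<in>#(\<Sum>v\<in>#V. X v). F x) = (\<Sum>v\<in>#V. \<Sum>x\<in>#X v. F x)"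
  by (induction V) auto

lemma sum_distribute_add_mset:
  "(\<Sum>f\<in>#distribute V (add_mset s M). F f) =
     (\<Sum>v\<in>#mset_set V. \<Sum>f\<in>#distribute V M. F (f(v := add_mset s (f v))))"
  by (simp add: distribute_add_mset sum_mset_sum_mset multiset.map_comp o_def)

lemma distribute_outside: "f \<in># distribute V M \<Longrightarrow> v \<notin> V \<Longrightarrow> f v = {#}"
proof (induction M arbitrary: f)
  case (add s M)
  then show ?case
    \<comment> \<open>For infinite \<open>V\<close> the default \<open>mset_set V = {#}\<close>
      leaves no placement of a non-empty multiset.\<close>
    by (cases "finite V") (auto simp: distribute_add_mset)
qed simp

lemma distribute_singleton: "distribute {v} M = {#(\<lambda>_. {#})(v := M)#}"
  by (induction M) (auto simp: distribute_add_mset)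

text \<open>Placing elements on a disjoint union means deciding first which of them go to
  \<open>V\<close> and which to \<open>W\<close>, and then placing the two blocks
  independently.\<close>

lemma sum_distribute_Un:
  fixes V W :: "'v set" and M :: "'a multiset"
  assumes "finite V" "finite W" "V \<inter> W = {}"
  shows "(\<Sum>f\<in>#distribute (V \<union> W) M. F f) =
    (\<Sum>(A, B)\<in>#splits M. \<Sum>f\<in>#distribute V A. \<Sum>g\<in>#distribute W B. F (\<lambda>v. f v + g v))"
proof (induction M arbitrary: F)
  case (add s M)
  \<comment> \<open>A new element at \<open>u\<close> can be credited to either summand of f + g;
    fact 1 serves \<open>u\<close> in \<open>V\<close> and fact 2 serves \<open>u\<close> in
    \<open>W\<close>.\<close>
  have 1: "(\<lambda>v. f v + g v)(u := add_mset s (f u + g u)) =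
      (\<lambda>v. (f(u := add_mset s (f u))) v + g v)" for f g :: "'v \<Rightarrow> 'a multiset" and u
    by (auto simp: fun_eq_iff)
  have 2: "(\<lambda>v. f v + g v)(u := add_mset s (f u + g u)) =
      (\<lambda>v. f v + (g(u := add_mset s (g u))) v)" for f g :: "'v \<Rightarrow> 'a multiset" and u
    by (auto simp: fun_eq_iff)
  have "(\<Sum>f\<in>#distribute (V \<union> W) (add_mset s M). F f) =
      (\<Sum>u\<in>#mset_set V. \<Sum>f\<in>#distribute (V \<union> W) M. F (f(u := add_mset s (f u)))) +
      (\<Sum>u\<in>#mset_set W. \<Sum>f\<in>#distribute (V \<union> W) M. F (f(u := add_mset s (f u))))"
    using assms by (simp add: sum_distribute_add_mset mset_set_Union)
  also have "(\<Sum>u\<in>#mset_set V. \<Sum>f\<in>#distribute (V \<union> W) M. F (f(u := add_mset s (f u)))) =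
      (\<Sum>u\<in>#mset_set V. \<Sum>(A, B)\<in>#splits M. \<Sum>f\<in>#distribute V A. \<Sum>g\<in>#distribute W B.
        F (\<lambda>v. (f(u := add_mset s (f u))) v + g v))"
    unfolding add 1 ..
  also have "\<dots> = (\<Sum>(A, B)\<in>#splits M. \<Sum>f\<in>#distribute V (add_mset s A). \<Sum>g\<in>#distribute W B.
        F (\<lambda>v. f v + g v))"
    by (subst sum_mset.swap) (simp add: sum_distribute_add_mset case_prod_unfold del: fun_upd_apply)
  also have "(\<Sum>u\<in>#mset_set W. \<Sum>f\<in>#distribute (V \<union> W) M. F (f(u := add_mset s (f u)))) =
      (\<Sum>u\<in>#mset_set W. \<Sum>(A, B)\<in>#splits M. \<Sum>f\<in>#distribute V A. \<Sum>g\<in>#distribute W B.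
        F (\<lambda>v. f v + (g(u := add_mset s (g u))) v))"
    unfolding add 2 ..
  also have "\<dots> = (\<Sum>(A, B)\<in>#splits M. \<Sum>f\<in>#distribute V A. \<Sum>g\<in>#distribute W (add_mset s B).
        F (\<lambda>v. f v + g v))"
    by (simp add: sum_distribute_add_mset case_prod_unfold sum_mset.swap[where A = "mset_set W"]
        del: fun_upd_apply)
  finally show ?case
    unfolding sum_splits_add_mset by (simp add: sum_mset.distrib case_prod_unfold)
qed simp

text \<open>Passes from the attaching maps of \<open>attach_sum\<close> to
  \<open>distribute\<close>; a map on one more index is a map on the old ones together with the
  value at the last index.\<close>

lemma sum_PiE_eq_sum_distribute:
  fixes V :: "'v set"
  assumes "finite V"
  shows "(\<Sum>\<phi>\<in>{..<length ss} \<rightarrow>\<^sub>E V.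
      F (\<lambda>v. image_mset ((!) ss) (mset_set {i. i < length ss \<and> \<phi> i = v}))) =
    (\<Sum>f\<in>#distribute V (mset ss). F f)"
proof (induction ss arbitrary: F rule: rev_induct)
  case Nil
  then show ?case by simp
next
  case (snoc s ss)
  let ?n = "length ss"
  let ?f = "\<lambda>\<phi> v. image_mset ((!) ss) (mset_set {i. i < ?n \<and> \<phi> i = v})"
  let ?g = "\<lambda>\<phi> v. image_mset ((!) (ss @ [s])) (mset_set {i. i < Suc ?n \<and> \<phi> i = v})"
  have g: "?g (\<phi>(?n := u)) = (?f \<phi>)(u := add_mset s (?f \<phi> u))" for \<phi> :: "nat \<Rightarrow> 'v" and u
  proof
    fix v
    let ?I = "{i. i < ?n \<and> \<phi> i = v}"
    have old: "image_mset ((!) (ss @ [s])) (mset_set ?I) = ?f \<phi> v"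
      by (intro image_mset_cong) (auto simp: nth_append)
    have "{i. i < Suc ?n \<and> (\<phi>(?n := u)) i = v} = (if v = u then insert ?n ?I else ?I)"
      by auto
    then show "?g (\<phi>(?n := u)) v = ((?f \<phi>)(u := add_mset s (?f \<phi> u))) v"
      using old by auto
  qed
  have inj: "inj_on (\<lambda>(u, \<phi>). \<phi>(?n := u)) (V \<times> ({..<?n} \<rightarrow>\<^sub>E V))"
    by (rule inj_combinator) simp
  have "(\<Sum>\<phi>\<in>{..<Suc ?n} \<rightarrow>\<^sub>E V. F (?g \<phi>)) =
      (\<Sum>(u, \<phi>)\<in>V \<times> ({..<?n} \<rightarrow>\<^sub>E V). F (?g (\<phi>(?n := u))))"
    unfolding lessThan_Suc PiE_insert_eq sum.reindex[OF inj]
    by (rule sum.cong) (auto simp del: fun_upd_apply)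
  also have "\<dots> = (\<Sum>u\<in>V. \<Sum>\<phi>\<in>{..<?n} \<rightarrow>\<^sub>E V. F ((?f \<phi>)(u := add_mset s (?f \<phi> u))))"
    unfolding g by (rule sum.cartesian_product[symmetric])
  also have "\<dots> = (\<Sum>u\<in>V. \<Sum>f\<in>#distribute V (mset ss). F (f(u := add_mset s (f u))))"
    by (intro sum.cong refl snoc)
  also have "\<dots> = (\<Sum>f\<in>#distribute V (mset (ss @ [s])). F f)"
    by (simp add: sum_distribute_add_mset sum_unfold_sum_mset)
  finally show ?case by simp
qed


section \<open>Grafting\<close>

text \<open>The terms, with multiplicity, of the product of \<open>Node () S\<close> with the tree
  labelled by \<open>L\<close>; see \<open>gl_mult_basis\<close>.\<close>

definition grafts :: "rtree multiset \<Rightarrow> 'v ltree \<Rightarrow> rtree multiset" where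
  "grafts S L = image_mset (\<lambda>f. graft f L) (distribute (vertices L) S)"

lemma grafts_leaf [simp]: "grafts S (Node v {#}) = {#Node () S#}"
  by (simp add: grafts_def distribute_singleton)

lemma grafts_nonleaf:
  "u \<in># grafts S L \<Longrightarrow> children L \<noteq> {#} \<Longrightarrow> children u \<noteq> {#}"
  by (cases L) (auto simp: grafts_def)

text \<open>The identity for G of the introduction, with x = \<open>Node v N\<close> and y =
  \<open>Y\<close>: each tree of \<open>S\<close> is attached either to a vertex of \<open>Y\<close>
  or to one of the remaining vertices.\<close>

lemma sum_grafts_add_mset:
  assumes "vertices Y \<inter> vertices (Node v N) = {}"
  shows "(\<Sum>u\<in>#grafts S (Node v (add_mset Y N)). F u) =
    (\<Sum>(A, B)\<in>#splits S. \<Sum>x\<in>#grafts A (Node v N). \<Sum>y\<in>#grafts B Y.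
       F (Node () (add_mset y (children x))))"
proof -
  have V: "vertices (Node v (add_mset Y N)) = vertices (Node v N) \<union> vertices Y"
    by auto
  have disj: "vertices (Node v N) \<inter> vertices Y = {}"
    using assms by blast
  have graft: "graft (\<lambda>u. f u + g u) (Node v (add_mset Y N)) =
      Node () (add_mset (graft g Y) (children (graft f (Node v N))))"
    if "f \<in># distribute (vertices (Node v N)) A" "g \<in># distribute (vertices Y) B" for f g A B
  proof -
    \<comment> \<open>A placement is empty off its own vertex set, so each of the two parts sees
      only one of \<open>f\<close> and \<open>g\<close>.\<close>
    have f: "f u = {#}" if "u \<in> vertices Y" for u
      using distribute_outside[OF \<open>f \<in># _\<close>] that assms by blast
    have g: "g u = {#}" if "u \<in> vertices (Node v N)" for u
      using distribute_outside[OF \<open>g \<in># _\<close>] that assms by blast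
    have "graft (\<lambda>u. f u + g u) Y = graft g Y"
      using f by (intro graft_cong) simp
    moreover have "graft (\<lambda>u. f u + g u) (Node v N) = graft f (Node v N)"
      using g by (intro graft_cong) simp
    ultimately show ?thesis by simp
  qed
  show ?thesis
    unfolding grafts_def V multiset.map_comp o_def
      sum_distribute_Un[OF finite_vertices finite_vertices disj]
    by (intro sum_splits_cong arg_cong[of _ _ sum_mset] image_mset_cong) (simp only: graft ltree.sel)
qed


section \<open>The coproduct of a product of trees\<close>

lemma distinct_labels_Node_add_mset:
  assumes "distinct_labels (Node v (add_mset Y N))"
  shows "distinct_labels (Node v N)" "vertices Y \<inter> vertices (Node v N) = {}"
proof -
  have le: "count (labels Y) u + count (labels (Node v N)) u \<le> 1" for u
    using assms by (auto simp: distinct_labels_def add_ac dest: spec[of _ u])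
  show "distinct_labels (Node v N)"
    unfolding distinct_labels_def using le by (metis add_leD2)
  show "vertices Y \<inter> vertices (Node v N) = {}"
  proof (rule ccontr)
    assume "vertices Y \<inter> vertices (Node v N) \<noteq> {}"
    then obtain u where "u \<in># labels Y" "u \<in># labels (Node v N)"
      unfolding set_mset_labels[symmetric] by blast
    then have "count (labels Y) u > 0" "count (labels (Node v N)) u > 0"
      by (simp_all only: count_greater_zero_iff)
    with le[of u] show False by linarith
  qed
qed

text \<open>This is \<Delta>(st) = \<Delta>(s)\<Delta>(t), tested against an arbitrary
  \<open>K\<close>. Splitting t duplicates its root; the second copy has its own label
  \<open>w\<close>, so that both copies can later be vertices of one tree. In the induction a child
  \<open>Y\<close>, with whatever is attached to it, falls to one of the two factors.\<close>

lemma sum_splits_grafts: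
  assumes "distinct_labels (Node v N)" "distinct_labels (Node w N)"
  shows "(\<Sum>u\<in>#grafts S (Node v N). \<Sum>(C, D)\<in>#splits (children u). K C D) =
    (\<Sum>(A, B)\<in>#splits S. \<Sum>(N1, N2)\<in>#splits N.
       \<Sum>x\<in>#grafts A (Node v N1). \<Sum>y\<in>#grafts B (Node w N2). K (children x) (children y))"
  using assms
proof (induction N arbitrary: S K)
  case (add Y N)
  note dv = distinct_labels_Node_add_mset[OF add.prems(1)]
  note dw = distinct_labels_Node_add_mset[OF add.prems(2)]
  \<comment> \<open>\<open>?T1\<close> collects the terms in which \<open>Y\<close> joins the first
    factor, \<open>?T2\<close> those in which it joins the second; \<open>B\<close> is the block
    attached to vertices of \<open>Y\<close>.\<close>
  let ?T1 = "\<lambda>A1 A2 B. \<Sum>y\<in>#grafts B Y. \<Sum>(N1, N2)\<in>#splits N.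
      \<Sum>x\<in>#grafts A1 (Node v N1). \<Sum>z\<in>#grafts A2 (Node w N2).
      K (add_mset y (children x)) (children z)"
  let ?T2 = "\<lambda>A1 A2 B. \<Sum>y\<in>#grafts B Y. \<Sum>(N1, N2)\<in>#splits N.
      \<Sum>x\<in>#grafts A1 (Node v N1). \<Sum>z\<in>#grafts A2 (Node w N2).
      K (children x) (add_mset y (children z))"
  have disj: "vertices Y \<inter> vertices (Node v N1) = {}" "vertices Y \<inter> vertices (Node w N2) = {}"
    if "N = N1 + N2" for N1 N2
    using dv(2) dw(2) that by auto
  have "(\<Sum>u\<in>#grafts S (Node v (add_mset Y N)). \<Sum>(C, D)\<in>#splits (children u). K C D) =
      (\<Sum>(A, B)\<in>#splits S. \<Sum>x\<in>#grafts A (Node v N). \<Sum>y\<in>#grafts B Y.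
        \<Sum>(C, D)\<in>#splits (children x). K (add_mset y C) D + K C (add_mset y D))"
    by (simp add: sum_grafts_add_mset[OF dv(2)] sum_splits_add_mset)
  also have "\<dots> = (\<Sum>(A, B)\<in>#splits S. \<Sum>y\<in>#grafts B Y. \<Sum>x\<in>#grafts A (Node v N).
        \<Sum>(C, D)\<in>#splits (children x). K (add_mset y C) D + K C (add_mset y D))"
    by (intro sum_splits_cong sum_mset.swap)
  also have "\<dots> = (\<Sum>(A, B)\<in>#splits S. \<Sum>y\<in>#grafts B Y. \<Sum>(A1, A2)\<in>#splits A.
      \<Sum>(N1, N2)\<in>#splits N. \<Sum>x\<in>#grafts A1 (Node v N1). \<Sum>z\<in>#grafts A2 (Node w N2).
      K (add_mset y (children x)) (children z) + K (children x) (add_mset y (children z)))"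
    by (simp only: add.IH[OF dv(1) dw(1)])
  also have "\<dots> = (\<Sum>(A, B)\<in>#splits S. \<Sum>(A1, A2)\<in>#splits A. ?T1 A1 A2 B + ?T2 A1 A2 B)"
    by (simp add: case_prod_unfold sum_mset.distrib sum_mset.swap[of _ "splits _" "grafts _ Y"])
  also have "\<dots> = (\<Sum>(A, B)\<in>#splits S. \<Sum>(A1, A2)\<in>#splits A. ?T1 A1 A2 B) +
      (\<Sum>(A, B)\<in>#splits S. \<Sum>(A1, A2)\<in>#splits A. ?T2 A1 A2 B)"
    by (simp only: case_prod_unfold sum_mset.distrib)
  \<comment> \<open>Here \<open>Y\<close> belongs to the first factor, so its block must be moved
    next to \<open>A1\<close> before the two merge into the block for
    \<open>Node v (add_mset Y N1)\<close>.\<close>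
  also have "(\<Sum>(A, B)\<in>#splits S. \<Sum>(A1, A2)\<in>#splits A. ?T1 A1 A2 B) =
      (\<Sum>(A, B)\<in>#splits S. \<Sum>(A1, A2)\<in>#splits A. ?T1 A1 B A2)"
    by (rule splits_rotate)
  also have "\<dots> = (\<Sum>(A, B)\<in>#splits S. \<Sum>(N1, N2)\<in>#splits N.
      \<Sum>(A1, A2)\<in>#splits A. \<Sum>x\<in>#grafts A1 (Node v N1). \<Sum>y\<in>#grafts A2 Y.
      \<Sum>z\<in>#grafts B (Node w N2). K (add_mset y (children x)) (children z))"
    by (simp add: case_prod_unfold sum_mset.swap[of _ "splits N"]
        sum_mset.swap[of _ "grafts _ (Node v _)" "grafts _ Y"])
  also have "\<dots> = (\<Sum>(A, B)\<in>#splits S. \<Sum>(N1, N2)\<in>#splits N.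
      \<Sum>x\<in>#grafts A (Node v (add_mset Y N1)). \<Sum>z\<in>#grafts B (Node w N2).
      K (children x) (children z))"
    by (intro sum_splits_cong) (simp only: sum_grafts_add_mset[OF disj(1)] ltree.sel)
  \<comment> \<open>Here \<open>Y\<close> belongs to the second factor, whose blocks
    \<open>A2\<close> and \<open>B\<close> are already adjacent, so reassociation suffices.\<close>
  also have "(\<Sum>(A, B)\<in>#splits S. \<Sum>(A1, A2)\<in>#splits A. ?T2 A1 A2 B) =
      (\<Sum>(A, B)\<in>#splits S. \<Sum>(B1, B2)\<in>#splits B. ?T2 A B1 B2)"
    by (rule splits_assoc)
  also have "\<dots> = (\<Sum>(A, B)\<in>#splits S. \<Sum>(N1, N2)\<in>#splits N.
      \<Sum>x\<in>#grafts A (Node v N1). \<Sum>(B1, B2)\<in>#splits B. \<Sum>z\<in>#grafts B1 (Node w N2).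
      \<Sum>y\<in>#grafts B2 Y. K (children x) (add_mset y (children z)))"
    by (simp add: case_prod_unfold sum_mset.swap[of _ "splits N"]
        sum_mset.swap[of _ "grafts _ (Node v _)" "grafts _ Y"]
        sum_mset.swap[of _ "grafts _ (Node v _)" "splits _"]
        sum_mset.swap[of _ "grafts _ (Node w _)" "grafts _ Y"])
  also have "\<dots> = (\<Sum>(A, B)\<in>#splits S. \<Sum>(N1, N2)\<in>#splits N.
      \<Sum>x\<in>#grafts A (Node v N1). \<Sum>z\<in>#grafts B (Node w (add_mset Y N2)).
      K (children x) (children z))"
    by (intro sum_splits_cong) (simp only: sum_grafts_add_mset[OF disj(2)] ltree.sel)
  finally show ?case
    unfolding sum_splits_add_mset by (simp add: case_prod_unfold sum_mset.distrib)
qed simp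

section \<open>Linear maps determined on a basis\<close>

abbreviation lin :: "(('b \<Rightarrow>\<^sub>0 'k) \<Rightarrow> ('c \<Rightarrow>\<^sub>0 'k::field)) \<Rightarrow> bool" where
  "lin \<equiv> Vector_Spaces.linear scale scale"

interpretation pair: vector_space_pair
  "scale :: 'k::field \<Rightarrow> ('b \<Rightarrow>\<^sub>0 'k) \<Rightarrow> _" "scale :: 'k::field \<Rightarrow> ('c \<Rightarrow>\<^sub>0 'k) \<Rightarrow> _"
  by unfold_locales

lemma lin_comp: "lin f \<Longrightarrow> lin g \<Longrightarrow> lin (\<lambda>x. f (g x))"
  using Vector_Spaces.linear_compose[of scale scale g scale f] by (simp add: o_def)

lemma lin_id: "lin (\<lambda>x. x)"
  by (rule scale.linear_ident)

lemma lin_sum_mset: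
  assumes "lin f"
  shows "f (\<Sum>x\<in>#X. g x) = (\<Sum>x\<in>#X. f (g x))"
  by (induction X) (simp_all add: pair.linear_0[OF assms] pair.linear_add[OF assms])

lemma lin_sum_splits:
  assumes "lin f"
  shows "f (\<Sum>(A, B)\<in>#X. g A B) = (\<Sum>(A, B)\<in>#X. f (g A B))"
  by (simp add: lin_sum_mset[OF assms] case_prod_unfold)

lemma sum_scale_basis: "(\<Sum>b\<in>Poly_Mapping.keys a. scale (Poly_Mapping.lookup a b) (basis b)) = a"
  by (rule poly_mapping_eqI)
    (simp add: lookup_sum basis_def lookup_single when_def if_distrib in_keys_iff cong: if_cong)

lemma lin_eqI:
  assumes "lin f" "lin g" "\<And>b. f (basis b) = g (basis b)"
  shows "f a = g a"
proof -
  have "f (\<Sum>b\<in>Poly_Mapping.keys a. scale (Poly_Mapping.lookup a b) (basis b)) =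
      g (\<Sum>b\<in>Poly_Mapping.keys a. scale (Poly_Mapping.lookup a b) (basis b))"
    by (simp add: pair.linear_sum[OF assms(1)] pair.linear_sum[OF assms(2)]
        pair.linear_scale[OF assms(1)] pair.linear_scale[OF assms(2)] assms(3))
  then show ?thesis by (simp add: sum_scale_basis)
qed

text \<open>The product and the tensor product are nested uses of \<open>lin_ext\<close>, with the
  second argument inside the function being extended; this gives linearity in that argument.\<close>

lemma lin_lin_ext_parameter:
  assumes "\<And>s. lin (g s)"
  shows "lin (\<lambda>b. lin_ext (\<lambda>s. g s b) a)"
  unfolding lin_ext_def
  by (intro pair.linear_compose_sum ballI pair.linear_compose_scale_right assms)

lemma lin_gl_mult_right: "lin ((\<star>) a)"
  unfolding gl_mult_def by (intro lin_lin_ext_parameter linear_lin_ext)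

lemma lin_gl_mult_left: "lin (\<lambda>a. a \<star> b)"
  unfolding gl_mult_def by (rule linear_lin_ext)

lemma lin_tensor_right: "lin ((\<otimes>) a)"
  unfolding tensor_def by (intro lin_lin_ext_parameter linear_lin_ext)

lemma lin_tensor_left: "lin (\<lambda>a. a \<otimes> b)"
  unfolding tensor_def by (rule linear_lin_ext)

lemma lin_gl_M: "lin gl_M"
  unfolding gl_M_def by (rule linear_lin_ext)

lemma lin_gl_coprod: "lin \<Delta>"
  unfolding gl_coprod_def by (rule linear_lin_ext)

lemma lin_tensor_map: "lin (tensor_map f g)"
  unfolding tensor_map_def by (rule linear_lin_ext)

text \<open>In the form of a \<open>lin_ext\<close>, the counit term inherits linearity and can be
  evaluated on trees by \<open>lin_ext_basis\<close>.\<close>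

lemma gl_scalar_counit:
  "gl_scalar (\<epsilon> a) = lin_ext (\<lambda>t. if t = tree_e then basis tree_e else 0) a"
  unfolding gl_scalar_def gl_counit_def lin_ext_def scale.scale_sum_left
  by (intro sum.cong) auto

lemma lin_gl_scalar_counit: "lin (\<lambda>a. gl_scalar (\<epsilon> a))"
  unfolding gl_scalar_counit by (rule linear_lin_ext)

lemmas lin_intros = lin_id pair.linear_compose_add pair.linear_compose_sub
  lin_comp[OF lin_gl_mult_right] lin_comp[OF lin_gl_mult_left]
  lin_comp[OF lin_tensor_right] lin_comp[OF lin_tensor_left]
  lin_comp[OF lin_gl_M] lin_comp[OF lin_gl_coprod] lin_comp[OF lin_tensor_map]
  lin_comp[OF lin_gl_scalar_counit]


section \<open>Structure maps on trees\<close>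

lemma Node_children [simp]: "Node () (children t) = (t :: rtree)"
  by (cases t) simp

lemma children_tree_e [simp]: "children tree_e = {#}"
  by (simp add: tree_e_def)

lemma tensor_basis [simp]: "basis s \<otimes> basis t = basis (s, t)"
  by (simp add: tensor_def)

lemma gl_coprod_basis:
  "\<Delta> (basis t) = (\<Sum>(A, B)\<in>#splits (children t). basis (Node () A, Node () B))"
proof -
  obtain ss where ss: "mset ss = children t"
    using ex_mset by blast
  show ?thesis
    unfolding gl_coprod_def lin_ext_basis tree_coprod_eq[OF ss] split_sum_def tensor_basis
    using sum_Pow_eq_sum_splits[of "\<lambda>A B. basis (Node () A, Node () B)" ss] ss by simp
qed

lemma gl_mult_basis:
  assumes "is_labelling t L"
  shows "basis s \<star> basis t = (\<Sum>u\<in>#grafts (children s) L. basis u)"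
proof -
  obtain ss where ss: "mset ss = children s"
    using ex_mset by blast
  show ?thesis
    unfolding gl_mult_def lin_ext_basis tree_mult_eq[OF ss assms] attach_sum_def grafts_def
      multiset.map_comp o_def ss[symmetric]
    by (rule sum_PiE_eq_sum_distribute) simp
qed

lemma gl_mult_unit: "a \<star> basis tree_e = a"
proof (rule lin_eqI[where f = "\<lambda>a. a \<star> basis tree_e" and g = "\<lambda>a. a"])
  fix t
  have "is_labelling tree_e (Node () {#})"
    by (simp add: is_labelling_def distinct_labels_def tree_e_def)
  then show "basis t \<star> basis tree_e = basis t"
    by (simp add: gl_mult_basis)
qed (intro lin_intros lin_gl_mult_left)+

text \<open>Each child of the root of t goes to the root of N(e) or to its other vertex, hence tN(e)
  = G(\<Delta>(t)).\<close>

lemma gl_mult_Ne: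
  "basis t \<star> basis tree_Ne =
     (\<Sum>(A, B)\<in>#splits (children t). basis (Node () (add_mset (Node () B) A)))"
proof -
  have "is_labelling tree_Ne (Node 0 {#Node (1 :: nat) {#}#})"
    by (simp add: is_labelling_def distinct_labels_def tree_Ne_def tree_e_def)
  then show ?thesis
    by (simp add: gl_mult_basis sum_grafts_add_mset)
qed

text \<open>The chain is (st)N(e) = G(\<Delta>(st)) = G(\<Delta>(s)\<Delta>(t)) = s G(\<Delta>(t)) =
  s(tN(e)).\<close>

lemma gl_mult_assoc_Ne_basis:
  "(basis s \<star> basis t) \<star> basis tree_Ne = basis s \<star> (basis t \<star> basis tree_Ne)"
proof -
  let ?S = "children s"
  obtain L :: "nat ltree" where L: "is_labelling t L"
    using ex_labelling_ge by blast
  obtain v N where vN: "L = Node v N" by (cases L)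
  have t: "children t = image_mset forget N"
    using L vN by (auto simp: is_labelling_def)
  \<comment> \<open>The fresh \<open>w\<close> names the vertex added by N(e), which is also the
    second copy of the root when t is split.\<close>
  obtain w where w: "w \<notin> vertices L"
    using ex_new_if_finite[OF infinite_UNIV_nat finite_vertices] by blast
  have count_w: "count (labels L) w = 0"
    using w by (simp add: not_in_iff[symmetric])
  have dv: "count (labels L) u \<le> 1" for u
    using L by (simp add: is_labelling_def distinct_labels_def)
  have dw: "distinct_labels (Node w N)"
    unfolding distinct_labels_def
  proof
    fix u
    show "count (labels (Node w N)) u \<le> 1"
      using dv[of u] count_w vN by (auto split: if_splits)
  qed
  have lab: "is_labelling (Node () (add_mset (Node () (image_mset forget N2)) (image_mset forget N1)))
      (Node v (add_mset (Node w N2) N1))" if "N = N1 + N2" for N1 N2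
  proof -
    have "count (labels (Node v (add_mset (Node w N2) N1))) u \<le> 1" for u
      using dv[of u] count_w that vN by (auto split: if_splits)
    then show ?thesis
      unfolding is_labelling_def distinct_labels_def by simp
  qed
  have disj: "vertices (Node w N2) \<inter> vertices (Node v N1) = {}" if "N = N1 + N2" for N1 N2
    by (rule distinct_labels_Node_add_mset(2))
      (use lab[OF that] in \<open>unfold is_labelling_def, blast\<close>)
  have "(basis s \<star> basis t) \<star> basis tree_Ne =
      (\<Sum>u\<in>#grafts ?S L. \<Sum>(A, B)\<in>#splits (children u).
        basis (Node () (add_mset (Node () B) A)))"
    by (simp add: gl_mult_basis[OF L] lin_sum_mset[OF lin_gl_mult_left] gl_mult_Ne)
  also have "\<dots> = (\<Sum>(A, B)\<in>#splits ?S. \<Sum>(N1, N2)\<in>#splits N.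
      \<Sum>x\<in>#grafts A (Node v N1). \<Sum>y\<in>#grafts B (Node w N2).
      basis (Node () (add_mset y (children x))))"
    using L dw unfolding vN is_labelling_def by (simp add: sum_splits_grafts[of v N w])
  also have "\<dots> = (\<Sum>(N1, N2)\<in>#splits N. \<Sum>(A, B)\<in>#splits ?S.
      \<Sum>x\<in>#grafts A (Node v N1). \<Sum>y\<in>#grafts B (Node w N2).
      basis (Node () (add_mset y (children x))))"
    by (simp add: case_prod_unfold sum_mset.swap[of _ "splits N"])
  \<comment> \<open>For a fixed split of \<open>N\<close>, the inner sum is s times the term of
    tN(e) in which \<open>w\<close> hangs below the root and carries \<open>N2\<close>.\<close>
  also have "\<dots> = (\<Sum>(N1, N2)\<in>#splits N. basis s \<star>
      basis (Node () (add_mset (Node () (image_mset forget N2)) (image_mset forget N1))))"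
    by (intro sum_splits_cong) (simp only: gl_mult_basis[OF lab] sum_grafts_add_mset[OF disj])
  also have "\<dots> = basis s \<star> (basis t \<star> basis tree_Ne)"
    unfolding gl_mult_Ne lin_sum_splits[OF lin_gl_mult_right] t splits_image_mset
    by (simp add: multiset.map_comp o_def case_prod_unfold)
  finally show ?thesis .
qed

section \<open>The map M: statements (1) and (2)\<close>

lemma gl_M_basis:
  "gl_M (basis t) = (if t = tree_e then 0 else basis t \<star> basis tree_Ne)"
  by (simp add: gl_M_def)

lemma tree_e_mult_Ne: "basis tree_e \<star> basis tree_Ne = basis tree_Ne"
  unfolding gl_mult_Ne by (simp add: tree_e_def tree_Ne_def)

lemma gl_M_eq: "gl_M b = (b - gl_scalar (\<epsilon> b)) \<star> basis tree_Ne"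
proof (rule lin_eqI[where f = gl_M and g = "\<lambda>b. (b - gl_scalar (\<epsilon> b)) \<star> basis tree_Ne"])
  fix t
  show "gl_M (basis t) = (basis t - gl_scalar (\<epsilon> (basis t))) \<star> basis tree_Ne"
    by (simp add: gl_M_basis gl_scalar_counit pair.linear_0[OF lin_gl_mult_left])
qed (intro lin_gl_M lin_intros)+

text \<open>For t = e both sides are M(s). Otherwise the counit term vanishes and no term of st is
  e, so M acts on st as right multiplication by N(e), and associativity applies.\<close>

lemma gl_M_mult_basis:
  "gl_M (basis s \<star> basis t) =
     basis s \<star> gl_M (basis t) + gl_M (basis s) \<star> gl_scalar (\<epsilon> (basis t))"
proof (cases "t = tree_e")
  case True
  then show ?thesis
    by (simp add: gl_mult_unit gl_M_basis[of tree_e] gl_scalar_counit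
        pair.linear_0[OF lin_gl_mult_right])
next
  case False
  obtain L :: "nat ltree" where L: "is_labelling t L"
    using ex_labelling_ge by blast
  then have "children L \<noteq> {#}"
    using False by (cases L) (auto simp: is_labelling_def tree_e_def)
  then have ne: "u \<noteq> tree_e" if "u \<in># grafts (children s) L" for u
    using grafts_nonleaf[OF that] by (auto simp: tree_e_def)
  have "gl_M (basis s \<star> basis t) = (\<Sum>u\<in>#grafts (children s) L. gl_M (basis u))"
    by (simp add: gl_mult_basis[OF L] lin_sum_mset[OF lin_gl_M])
  also have "\<dots> = (\<Sum>u\<in>#grafts (children s) L. basis u \<star> basis tree_Ne)"
    using ne by (intro arg_cong[of _ _ sum_mset] image_mset_cong) (simp add: gl_M_basis)
  also have "\<dots> = (basis s \<star> basis t) \<star> basis tree_Ne"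
    by (simp add: gl_mult_basis[OF L] lin_sum_mset[OF lin_gl_mult_left])
  finally show ?thesis
    using False by (simp add: gl_mult_assoc_Ne_basis gl_M_basis[of t] gl_scalar_counit
        pair.linear_0[OF lin_gl_mult_right])
qed

lemma gl_M_mult: "gl_M (a \<star> b) = a \<star> gl_M b + gl_M a \<star> gl_scalar (\<epsilon> b)"
proof (rule lin_eqI[where f = "\<lambda>a. gl_M (a \<star> b)" and
      g = "\<lambda>a. a \<star> gl_M b + gl_M a \<star> gl_scalar (\<epsilon> b)"])
  fix s
  show "gl_M (basis s \<star> b) = basis s \<star> gl_M b + gl_M (basis s) \<star> gl_scalar (\<epsilon> b)"
    by (rule lin_eqI[where f = "\<lambda>b. gl_M (basis s \<star> b)" and
          g = "\<lambda>b. basis s \<star> gl_M b + gl_M (basis s) \<star> gl_scalar (\<epsilon> b)"])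
      (intro gl_M_mult_basis lin_intros)+
qed (intro lin_intros)+

section \<open>The coproduct of M(b): statement (3)\<close>

text \<open>
  Since \<open>M\<close> vanishes at \<open>e\<close>, each of the two tensor maps misses the one summand in which
  all children of the root are on the other side.
\<close>

lemma tensor_map_id_gl_M_coprod:
  "tensor_map id gl_M (\<Delta> (basis t)) + basis t \<otimes> basis tree_Ne =
     (\<Sum>(A, B)\<in>#splits (children t). basis (Node () A) \<otimes> (basis (Node () B) \<star> basis tree_Ne))"
proof -
  have "tensor_map id gl_M (\<Delta> (basis t)) + basis t \<otimes> basis tree_Ne =
      (\<Sum>(A, B)\<in>#splits (children t). basis (Node () A) \<otimes> gl_M (basis (Node () B))) +
      (\<Sum>(A, B)\<in>#splits (children t). if B = {#} then basis (Node () A) \<otimes> basis tree_Ne else 0)"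
    unfolding gl_coprod_basis lin_sum_splits[OF lin_tensor_map] sum_splits_right_empty
    by (simp add: tensor_map_def)
  also have "\<dots> = (\<Sum>(A, B)\<in>#splits (children t).
      basis (Node () A) \<otimes> gl_M (basis (Node () B)) +
      (if B = {#} then basis (Node () A) \<otimes> basis tree_Ne else 0))"
    by (simp only: case_prod_unfold sum_mset.distrib)
  also have "\<dots> = (\<Sum>(A, B)\<in>#splits (children t).
      basis (Node () A) \<otimes> (basis (Node () B) \<star> basis tree_Ne))"
    by (intro sum_splits_cong) (simp add: gl_M_basis tree_e_mult_Ne[unfolded tree_e_def]
        tree_e_def pair.linear_0[OF lin_tensor_right])
  finally show ?thesis .
qed

lemma tensor_map_gl_M_id_coprod:
  "tensor_map gl_M id (\<Delta> (basis t)) + basis tree_Ne \<otimes> basis t =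
     (\<Sum>(A, B)\<in>#splits (children t). (basis (Node () A) \<star> basis tree_Ne) \<otimes> basis (Node () B))"
proof -
  have "tensor_map gl_M id (\<Delta> (basis t)) + basis tree_Ne \<otimes> basis t =
      (\<Sum>(A, B)\<in>#splits (children t). gl_M (basis (Node () A)) \<otimes> basis (Node () B)) +
      (\<Sum>(A, B)\<in>#splits (children t). if A = {#} then basis tree_Ne \<otimes> basis (Node () B) else 0)"
    unfolding gl_coprod_basis lin_sum_splits[OF lin_tensor_map] sum_splits_left_empty
    by (simp add: tensor_map_def)
  also have "\<dots> = (\<Sum>(A, B)\<in>#splits (children t).
      gl_M (basis (Node () A)) \<otimes> basis (Node () B) +
      (if A = {#} then basis tree_Ne \<otimes> basis (Node () B) else 0))"
    by (simp only: case_prod_unfold sum_mset.distrib)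
  also have "\<dots> = (\<Sum>(A, B)\<in>#splits (children t).
      (basis (Node () A) \<star> basis tree_Ne) \<otimes> basis (Node () B))"
    by (intro sum_splits_cong) (simp add: gl_M_basis tree_e_mult_Ne[unfolded tree_e_def]
        tree_e_def pair.linear_0[OF lin_tensor_left])
  finally show ?thesis .
qed

text \<open>Multiplicativity of \<Delta> for the primitive element N(e). In a term of tN(e) the new
  child of the root, carrying \<open>B\<close>, goes to the left or to the right factor.\<close>

lemma coprod_mult_Ne:
  "\<Delta> (basis t \<star> basis tree_Ne) =
     (\<Sum>(A, B)\<in>#splits (children t). basis (Node () A) \<otimes> (basis (Node () B) \<star> basis tree_Ne)) +
     (\<Sum>(A, B)\<in>#splits (children t). (basis (Node () A) \<star> basis tree_Ne) \<otimes> basis (Node () B))"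
    (is "_ = ?R1 + ?R2")
proof -
  let ?b = "\<lambda>A B. basis (Node () A, Node () B)"
  have "\<Delta> (basis t \<star> basis tree_Ne) =
      (\<Sum>(A, B)\<in>#splits (children t). \<Sum>(C, D)\<in>#splits A.
        ?b (add_mset (Node () B) C) D + ?b C (add_mset (Node () B) D))"
    by (simp only: gl_mult_Ne lin_sum_splits[OF lin_gl_coprod] gl_coprod_basis ltree.sel
        sum_splits_add_mset)
  also have "\<dots> =
      (\<Sum>(A, B)\<in>#splits (children t). \<Sum>(C, D)\<in>#splits A. ?b (add_mset (Node () B) C) D) +
      (\<Sum>(A, B)\<in>#splits (children t). \<Sum>(C, D)\<in>#splits A. ?b C (add_mset (Node () B) D))"
    by (simp only: case_prod_unfold sum_mset.distrib)
  \<comment> \<open>The new child went left, so the block below it is brought together with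
    \<open>C\<close>; the two form a split of the first block of \<Delta>(t).\<close>
  also have "(\<Sum>(A, B)\<in>#splits (children t). \<Sum>(C, D)\<in>#splits A. ?b (add_mset (Node () B) C) D) =
      (\<Sum>(A, B)\<in>#splits (children t). \<Sum>(C, D)\<in>#splits A. ?b (add_mset (Node () D) C) B)"
    by (rule splits_rotate)
  also have "\<dots> = ?R2"
    by (simp only: gl_mult_Ne lin_sum_splits[OF lin_tensor_left] ltree.sel tensor_basis)
  \<comment> \<open>The new child went right, where \<open>D\<close> and the block below it together
    form the second block of \<Delta>(t).\<close>
  also have "(\<Sum>(A, B)\<in>#splits (children t). \<Sum>(C, D)\<in>#splits A. ?b C (add_mset (Node () B) D)) =
      (\<Sum>(A, B)\<in>#splits (children t). \<Sum>(C, D)\<in>#splits B. ?b A (add_mset (Node () D) C))"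
    by (rule splits_assoc)
  also have "\<dots> = ?R1"
    by (simp only: gl_mult_Ne lin_sum_splits[OF lin_tensor_right] ltree.sel tensor_basis)
  finally show ?thesis by (simp only: add.commute)
qed

text \<open>At e every summand is zero, since M(e) = 0 and e - \<epsilon>(e)e = 0. At any other tree
  the counit vanishes, and the two tensor maps completed by their missing summands are the two sums
  of \<open>coprod_mult_Ne\<close>.\<close>

lemma coprod_gl_M:
  "\<Delta> (gl_M b) = (tensor_map id gl_M (\<Delta> b) + tensor_map gl_M id (\<Delta> b))
     + (b - gl_scalar (\<epsilon> b)) \<otimes> basis tree_Ne + basis tree_Ne \<otimes> (b - gl_scalar (\<epsilon> b))"
proof (rule lin_eqI[where f = "\<lambda>b. \<Delta> (gl_M b)" and
      g = "\<lambda>b. (tensor_map id gl_M (\<Delta> b) + tensor_map gl_M id (\<Delta> b))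
        + (b - gl_scalar (\<epsilon> b)) \<otimes> basis tree_Ne + basis tree_Ne \<otimes> (b - gl_scalar (\<epsilon> b))"])
  fix t
  show "\<Delta> (gl_M (basis t)) =
      (tensor_map id gl_M (\<Delta> (basis t)) + tensor_map gl_M id (\<Delta> (basis t)))
      + (basis t - gl_scalar (\<epsilon> (basis t))) \<otimes> basis tree_Ne
      + basis tree_Ne \<otimes> (basis t - gl_scalar (\<epsilon> (basis t)))"
  proof (cases "t = tree_e")
    case True
    then show ?thesis
      by (simp add: gl_coprod_basis tensor_map_def gl_M_basis gl_scalar_counit
          tree_e_def[symmetric] pair.linear_0[OF lin_gl_coprod] pair.linear_0[OF lin_tensor_left]
          pair.linear_0[OF lin_tensor_right])
  next
    case False
    then show ?thesis
      by (simp add: gl_M_basis gl_scalar_counit coprod_mult_Ne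
          tensor_map_id_gl_M_coprod[symmetric] tensor_map_gl_M_id_coprod[symmetric] del: tensor_basis)
  qed
qed (intro lin_intros)+

theorem proposition2p4:
  shows "(\<forall>b :: rtree \<Rightarrow>\<^sub>0 'k::field_char_0. gl_M b = (b - gl_scalar (\<epsilon> b)) \<star> basis tree_Ne) \<and>
    (\<forall>a b :: rtree \<Rightarrow>\<^sub>0 'k. gl_M (a \<star> b) = a \<star> gl_M b + gl_M a \<star> gl_scalar (\<epsilon> b)) \<and>
    (\<forall>b :: rtree \<Rightarrow>\<^sub>0 'k. \<Delta> (gl_M b) =
       (tensor_map id gl_M (\<Delta> b) + tensor_map gl_M id (\<Delta> b))
       + (b - gl_scalar (\<epsilon> b)) \<otimes> basis tree_Ne + basis tree_Ne \<otimes> (b - gl_scalar (\<epsilon> b)))"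
  using gl_M_eq gl_M_mult coprod_gl_M by blast

end
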